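(* Let $\mathcal{X},\mathcal{Y},\mathcal{Z}$ be Euclidean spaces, let $\emptyset\neq C\subset\mathcal{X}$ be a connected closed embedded submanifold of $\mathcal{X}$, and let $F:=h+g\circ\mathfrak{S}:\mathcal{X}\to\mathbb{R}$ where: $h:\mathcal{X}\to\mathbb{R}$ is continuously differentiable with $\nabla h$ Lipschitz continuous over $C$ with constant $L_{\nabla h}>0$; $\mathfrak{S}:\mathcal{X}\to\mathcal{Z}$ is continuously differentiable; $g:\mathcal{Z}\to\mathbb{R}$ is Lipschitz continuous with constant $L_g>0$ and $\eta$-weakly convex with $\eta>0$; and $\inf_{\bm{x}\in C}F(\bm{x})>-\infty$. Let $\bm{\varphi}:\mathcal{Y}\to\mathcal{X}$ be continuously differentiable with $\bm{\varphi}(\mathcal{Y})=C$. Let $\bm{y}_1\in\mathcal{Y}$, $c\in(0,1)$, and $\mu_n:=\tau n^{-1/3}$ $(n\in\mathbb{N})$ with $\tau\in(0,(2\eta)^{-1}]$. Put $F_n:=h+{}^{\mu_n}g\circ\mathfrak{S}$ and consider the iteration $\bm{y}_{n+1}=\bm{y}_n-\gamma_n\nabla(F_n\circ\bm{\varphi})(\bm{y}_n)$ with stepsizes $\gamma_n>0$. Assume: (A) there are $\varpi_1\ge0$ and $\varpi_2>0$ such that for all $n\in\mathbb{N}$, $\nabla(F_n\circ\bm{\varphi})$ is Lipschitz continuous on $\mathcal{Y}$ with constant $L_n:=\varpi_1+\varpi_2\mu_n^{-1}$; (B) there is $\beta>0$ such that for all $n\in\mathbb{N}$, $\gamma_n\ge\beta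 L_n^{-1}$ and $\gamma_n$ satisfies the Armijo condition $F_n\circ\bm{\varphi}(\bm{y}_n-\gamma_n\nabla(F_n\circ\bm{\varphi})(\bm{y}_n))\le F_n\circ\bm{\varphi}(\bm{y}_n)-c\gamma_n\|\nabla(F_n\circ\bm{\varphi})(\bm{y}_n)\|^2$. Then, for any given $\epsilon>0$, the iteration finds an $\epsilon$-approximate stationary point of $F\circ\bm{\varphi}$ (i) with at most $\mathcal{O}(\epsilon^{-3})$ first-order oracle calls if $\gamma_n:=2(1-c)L_n^{-1}$ $(n\in\mathbb{N})$; and (ii) with at most $\mathcal{O}(\epsilon^{-3}\log(\epsilon^{-1}))$ first-order oracle calls if, for each $n$, $\gamma_n$ is given by the backtracking algorithm with parameters $\rho\in(0,1)$ and $\gamma_{\rm init}>0$.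
   Context: A Euclidean space is a finite-dimensional real Hilbert space. $g$ is $\eta$-weakly convex if $g+\frac{\eta}{2}\|\cdot\|^2$ is convex. For $\mu\in(0,\eta^{-1})$ the proximity operator and Moreau envelope are $\mathrm{prox}_{\mu g}(\bar{\bm{z}}):=\mathrm{argmin}_{\bm{z}\in\mathcal{Z}}\left(g(\bm{z})+\frac{1}{2\mu}\|\bm{z}-\bar{\bm{z}}\|^2\right)$ (single-valued) and ${}^{\mu}g(\bar{\bm{z}}):=\inf_{\bm{z}\in\mathcal{Z}}\left(g(\bm{z})+\frac{1}{2\mu}\|\bm{z}-\bar{\bm{z}}\|^2\right)$; ${}^{\mu}g$ is known to be continuously differentiable with $\nabla\,{}^{\mu}g=\mu^{-1}(\mathrm{Id}-\mathrm{prox}_{\mu g})$. Embedded submanifold: $C\subset\mathcal{X}$ is a $d$-dimensional embedded submanifold if each $\bar{\bm{x}}\in C$ has an open neighborhood $\mathcal{N}_{\bar{\bm{x}}}\subset\mathcal{X}$ and a continuously differentiable $H_{\bar{\bm{x}}}:\mathcal{N}_{\bar{\bm{x}}}\to\mathbb{R}^{\dim(\mathcal{X})-d}$ with $C\cap\mathcal{N}_{\bar{\bm{x}}}=H_{\bar{\bm{x}}}^{-1}(\bm{0})$ and $\mathrm{Rank}(\mathrm{D}H_{\bar{\bm{x}}}(\bar{\bm{x}}))=\dim(\mathcal{X})-d$. $\epsilon$-approximate stationary point: a point $\hat{\bm{y}}\in\mathcal{Y}$ with $\|\nabla((h+{}^{\mu}g\circ\mathfrak{S})\circ\bm{\varphi})(\hat{\bm{y}})\|\le\epsilon$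 for some $\mu\in(0,\epsilon]$. The iteration "finds" such a point when some iterate $\bm{y}_n$ is one; the oracle calls counted are those used up to that iterate. First-order oracle: one call, given $\bm{x},\bm{u}\in\mathcal{X}$, $\bm{y}\in\mathcal{Y}$, $\bm{z},\bm{v}\in\mathcal{Z}$, $\mu\in(0,\eta^{-1})$, returns $h(\bm{x})$, $\nabla h(\bm{x})$, $\mathfrak{S}(\bm{x})$, $(\mathrm{D}\mathfrak{S}(\bm{x}))^*[\bm{v}]$, $\bm{\varphi}(\bm{y})$, $(\mathrm{D}\bm{\varphi}(\bm{y}))^*[\bm{u}]$, $g(\bm{z})$, $\mathrm{prox}_{\mu g}(\bm{z})$. Thus one evaluation of both $(h+{}^{\mu}g\circ\mathfrak{S})\circ\bm{\varphi}$ and its gradient at one point costs at most five oracle calls. Backtracking algorithm (at iteration $n$): start with $\gamma_n\leftarrow\gamma_{\rm init}$; compute $f_n=F_n\circ\bm{\varphi}(\bm{y}_n)$ and $\bm{d}_n=\nabla(F_n\circ\bm{\varphi})(\bm{y}_n)$ once; while $F_n\circ\bm{\varphi}(\bm{y}_n-\gamma_n\bm{d}_n)>f_n-c\gamma_n\|\bm{d}_n\|^2$, replace $\gamma_n\leftarrow\rho\gamma_n$; return $\gamma_n$. $\mathcal{O}$ is Landau's notation as $\epsilon\searrow0$, with all problem data and parameters other than $\epsilon$ fixed. *)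

theory Defs
  imports
    "HOL-Analysis.Analysis"
    "HOL-Library.While_Combinator"
    "HOL-Library.Landau_Symbols"
begin

section \<open>Calculus and geometry\<close>

definition grad :: "('a::euclidean_space \<Rightarrow> real) \<Rightarrow> 'a \<Rightarrow> 'a" where
  "grad f x = (THE D. GDERIV f x :> D)"

text \<open>Intended for open sets \<open>A\<close>.\<close>

definition C1_on :: "'a::euclidean_space set \<Rightarrow> ('a \<Rightarrow> 'b::euclidean_space) \<Rightarrow> bool" where
  "C1_on A f \<longleftrightarrow> (\<exists>f' :: 'a \<Rightarrow> 'a \<Rightarrow>\<^sub>L 'b.
     (\<forall>x\<in>A. (f has_derivative blinfun_apply (f' x)) (at x)) \<and> continuous_on A f')"

text \<open>The codomain \<open>\<real>\<^sup>k\<close>, \<open>k = DIM('a) - d\<close>, of a local defining function varies with \<open>d\<close>;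
  since \<open>k \<le> DIM('a)\<close>, it is realised as some \<open>k\<close>-dimensional linear subspace \<open>V\<close> of \<open>'a\<close>.\<close>

definition embedded_submanifold :: "nat \<Rightarrow> 'a::euclidean_space set \<Rightarrow> bool" where
  "embedded_submanifold d C \<longleftrightarrow> d \<le> DIM('a) \<and>
     (\<forall>x\<in>C. \<exists>N V. \<exists>H :: 'a \<Rightarrow> 'a.
        open N \<and> x \<in> N \<and>
        subspace V \<and> dim V = DIM('a) - d \<and> H ` N \<subseteq> V \<and>
        C1_on N H \<and>
        C \<inter> N = {w \<in> N. H w = 0} \<and>
        dim (range (frechet_derivative H (at x))) = DIM('a) - d)"

section \<open>Weak convexity, proximity operator, Moreau envelope\<close>

definition weakly_convex :: "real \<Rightarrow> ('a::euclidean_space \<Rightarrow> real) \<Rightarrow> bool" where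
  "weakly_convex \<eta> g \<longleftrightarrow> convex_on UNIV (\<lambda>z. g z + \<eta> / 2 * (norm z)\<^sup>2)"

text \<open>Both notions are used only for Lipschitz, \<open>\<eta>\<close>-weakly convex \<open>g\<close> and \<open>0 < \<mu> < 1 / \<eta>\<close>, where the
  minimiser exists and is unique and the infimum is finite.\<close>

definition prox :: "real \<Rightarrow> ('a::euclidean_space \<Rightarrow> real) \<Rightarrow> 'a \<Rightarrow> 'a" where
  "prox \<mu> g z0 = (ARG_MIN (\<lambda>z. g z + 1 / (2 * \<mu>) * (norm (z - z0))\<^sup>2) z. True)"

definition moreau_env :: "real \<Rightarrow> ('a::euclidean_space \<Rightarrow> real) \<Rightarrow> 'a \<Rightarrow> real" where
  "moreau_env \<mu> g z0 = (INF z. g z + 1 / (2 * \<mu>) * (norm (z - z0))\<^sup>2)"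

text \<open>\<open>(h + \<^sup>\<mu>g \<circ> S) \<circ> \<phi>\<close>\<close>

definition smoothed ::
  "('x::euclidean_space \<Rightarrow> real) \<Rightarrow> ('x \<Rightarrow> 'z::euclidean_space) \<Rightarrow> ('z \<Rightarrow> real) \<Rightarrow>
   ('y::euclidean_space \<Rightarrow> 'x) \<Rightarrow> real \<Rightarrow> 'y \<Rightarrow> real" where
  "smoothed h S g \<phi> \<mu> y = h (\<phi> y) + moreau_env \<mu> g (S (\<phi> y))"

text \<open>The restriction \<open>\<mu> < 1 / \<eta>\<close> is the range in which the Moreau envelope is defined.\<close>

definition approx_stationary ::
  "('x::euclidean_space \<Rightarrow> real) \<Rightarrow> ('x \<Rightarrow> 'z::euclidean_space) \<Rightarrow> ('z \<Rightarrow> real) \<Rightarrow>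
   ('y::euclidean_space \<Rightarrow> 'x) \<Rightarrow> real \<Rightarrow> real \<Rightarrow> 'y \<Rightarrow> bool" where
  "approx_stationary h S g \<phi> \<eta> \<epsilon> y \<longleftrightarrow>
     (\<exists>\<mu>. 0 < \<mu> \<and> \<mu> \<le> \<epsilon> \<and> \<mu> < 1 / \<eta> \<and> norm (grad (smoothed h S g \<phi> \<mu>) y) \<le> \<epsilon>)"

section \<open>First-order oracle\<close>

text \<open>A query is a tuple \<open>(x, u, y, z, v, \<mu>)\<close>.\<close>

type_synonym ('x, 'y, 'z) query = "'x \<times> 'x \<times> 'y \<times> 'z \<times> 'z \<times> real"

record ('x, 'y, 'z) answer =
  h_val :: real
  h_grad :: 'x
  S_val :: 'z
  S_adj :: 'x
  phi_val :: 'x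
  phi_adj :: 'y
  g_val :: real
  prox_val :: 'z

definition fo_oracle ::
  "('x::euclidean_space \<Rightarrow> real) \<Rightarrow> ('x \<Rightarrow> 'z::euclidean_space) \<Rightarrow> ('z \<Rightarrow> real) \<Rightarrow>
   ('y::euclidean_space \<Rightarrow> 'x) \<Rightarrow> ('x, 'y, 'z) query \<Rightarrow> ('x, 'y, 'z) answer" where
  "fo_oracle h S g \<phi> = (\<lambda>(x, u, y, z, v, \<mu>).
     \<lparr> h_val = h x, h_grad = grad h x,
       S_val = S x, S_adj = adjoint (frechet_derivative S (at x)) v,
       phi_val = \<phi> y, phi_adj = adjoint (frechet_derivative \<phi> (at y)) u,
       g_val = g z, prox_val = prox \<mu> g z \<rparr>)"

text \<open>Programs that learn about the problem data only through oracle calls; running one against an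
  oracle yields its result together with the number of calls.\<close>

datatype ('q, 'r, 'a) oracle_prog =
    Return 'a
  | Call 'q "'r \<Rightarrow> ('q, 'r, 'a) oracle_prog"

primrec run :: "('q \<Rightarrow> 'r) \<Rightarrow> ('q, 'r, 'a) oracle_prog \<Rightarrow> 'a \<times> nat" where
  "run \<Omega> (Return a) = (a, 0)"
| "run \<Omega> (Call q k) = (let (a, n) = run \<Omega> (k (\<Omega> q)) in (a, Suc n))"

text \<open>Evaluation of \<open>smoothed h S g \<phi> \<mu>\<close> and its gradient at \<open>y\<close>. With \<open>x = \<phi> y\<close>, \<open>z = S x\<close> and
  \<open>p = prox \<mu> g z\<close>, the envelope has value \<open>g p + \<parallel>p - z\<parallel>\<^sup>2 / (2\<mu>)\<close> and gradient \<open>(z - p) / \<mu>\<close> at \<open>z\<close>;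
  the chain rule gives the rest. Query entries whose answer is not used are set to \<open>0\<close>.\<close>

definition eval_prog ::
  "real \<Rightarrow> 'y \<Rightarrow> (('x::euclidean_space, 'y::euclidean_space, 'z::euclidean_space) query,
     ('x, 'y, 'z) answer, real \<times> 'y) oracle_prog" where
  "eval_prog \<mu> y =
     Call (0, 0, y, 0, 0, \<mu>) (\<lambda>r1. let x = phi_val r1 in
     Call (x, 0, y, 0, 0, \<mu>) (\<lambda>r2. let z = S_val r2 in
     Call (x, 0, y, z, 0, \<mu>) (\<lambda>r3. let p = prox_val r3 in
     Call (x, 0, y, p, (1 / \<mu>) *\<^sub>R (z - p), \<mu>) (\<lambda>r4.
     Call (x, h_grad r2 + S_adj r4, y, p, 0, \<mu>) (\<lambda>r5.
     Return (h_val r2 + g_val r4 + 1 / (2 * \<mu>) * (norm (p - z))\<^sup>2, phi_adj r5))))))"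

lemma run_eval_prog_calls: "snd (run \<Omega> (eval_prog \<mu> y)) = 5"
  by (simp add: eval_prog_def Let_def split_beta)

text \<open>Backtracking at the point \<open>y\<close>: the result is the returned stepsize and the number of oracle
  calls, \<open>None\<close> meaning that the loop does not terminate. The loop state holds the current trial
  stepsize and the calls made before testing it; the calls of the final, successful test are added
  at the end. Every test is charged a full evaluation at the trial point.\<close>

definition backtracking ::
  "(('x::euclidean_space, 'y::euclidean_space, 'z::euclidean_space) query \<Rightarrow> ('x, 'y, 'z) answer) \<Rightarrow>
   real \<Rightarrow> real \<Rightarrow> real \<Rightarrow> real \<Rightarrow> 'y \<Rightarrow> (real \<times> nat) option" where
  "backtracking \<Omega> c \<rho> \<gamma>_init \<mu> y =
    (let ((f, d), k0) = run \<Omega> (eval_prog \<mu> y);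
         trial = (\<lambda>\<gamma>. run \<Omega> (eval_prog \<mu> (y - \<gamma> *\<^sub>R d)));
         trial_val = (\<lambda>\<gamma>. fst (fst (trial \<gamma>)));
         trial_calls = (\<lambda>\<gamma>. snd (trial \<gamma>))
     in map_option (\<lambda>(\<gamma>, k). (\<gamma>, k + trial_calls \<gamma>))
          (while_option
             (\<lambda>(\<gamma>, k). trial_val \<gamma> > f - c * \<gamma> * (norm d)\<^sup>2)
             (\<lambda>(\<gamma>, k). (\<rho> * \<gamma>, k + trial_calls \<gamma>))
             (\<gamma>_init, k0)))"

text \<open>\<open>calls k\<close> is the number of oracle calls made in iteration \<open>k = 1, 2, \<dots>\<close>, which works at the
  iterate \<open>y\<^sub>k\<close>. The total includes the iteration at the first iterate satisfying \<open>P\<close>.\<close>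

definition calls_until :: "(nat \<Rightarrow> nat) \<Rightarrow> (nat \<Rightarrow> bool) \<Rightarrow> nat" where
  "calls_until calls P = (\<Sum>k = 1..(LEAST n. 1 \<le> n \<and> P n). calls k)"

end

theory Submission
  imports Defs "HOL-Real_Asymp.Real_Asymp"
begin

text \<open>As \<open>\<mu>\<close> shrinks from \<open>\<mu>\<^sub>n\<close> to \<open>\<mu>\<^sub>n\<^sub>+\<^sub>1\<close>, the Moreau envelope of the Lipschitz function \<open>g\<close> grows by at
  most a multiple of \<open>\<mu>\<^sub>n - \<mu>\<^sub>n\<^sub>+\<^sub>1\<close>, so the Armijo inequalities telescope. With \<open>\<gamma>\<^sub>n \<ge> \<beta> / L\<^sub>n\<close> and
  \<open>L\<^sub>n = O(n\<^sup>1\<^sup>/\<^sup>3)\<close> the gradient norms \<open>d\<^sub>k\<close> therefore satisfy \<open>\<Sum>\<^sub>k k\<^sup>-\<^sup>1\<^sup>/\<^sup>3 d\<^sub>k\<^sup>2 < \<infinity>\<close>. If all of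
  \<open>d\<^sub>m, \<dots>, d\<^sub>2\<^sub>m\<close> exceeded \<open>\<epsilon>\<close>, this sum would be at least of order \<open>m\<^sup>2\<^sup>/\<^sup>3 \<epsilon>\<^sup>2\<close>, which is too large
  once \<open>m \<ge> (R / \<epsilon>)\<^sup>3\<close> for a suitable constant \<open>R\<close>. Backtracking reaches
  \<open>\<gamma>\<^sub>n = \<rho>\<^sup>m \<gamma>\<^sub>i\<^sub>n\<^sub>i\<^sub>t \<ge> \<beta> / L\<^sub>n\<close> with \<open>m = O(log n)\<close> reductions, hence the extra logarithm.\<close>

section \<open>Moreau envelopes of a Lipschitz function\<close>

lemma moreau_objective_ge:
  fixes g :: "'a::euclidean_space \<Rightarrow> real"
  assumes "L-lipschitz_on UNIV g" and "0 < \<mu>"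
  shows "g z0 - L\<^sup>2 * \<mu> / 2 \<le> g z + 1 / (2 * \<mu>) * (norm (z - z0))\<^sup>2"
proof -
  let ?r = "norm (z - z0)"
  have "\<bar>g z - g z0\<bar> \<le> L * ?r"
    using lipschitz_onD[OF assms(1), of z z0] by (simp add: dist_norm)
  \<comment> \<open>The Lipschitz loss \<open>L * ?r\<close> minus the quadratic penalty is largest
    at \<open>?r = L * \<mu>\<close>; completing the square there gives the constant.\<close>
  moreover have "0 \<le> (?r - L * \<mu>)\<^sup>2 / (2 * \<mu>)"
    using assms(2) by simp
  moreover have "(?r - L * \<mu>)\<^sup>2 / (2 * \<mu>) = 1 / (2 * \<mu>) * ?r\<^sup>2 - L * ?r + L\<^sup>2 * \<mu> / 2"
    using assms(2) by (simp add: field_simps power2_eq_square)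
  ultimately show ?thesis by linarith
qed

lemma moreau_env_ge:
  fixes g :: "'a::euclidean_space \<Rightarrow> real"
  assumes "L-lipschitz_on UNIV g" and "0 < \<mu>"
  shows "g z0 - L\<^sup>2 * \<mu> / 2 \<le> moreau_env \<mu> g z0"
  unfolding moreau_env_def using moreau_objective_ge[OF assms] by (intro cINF_greatest) auto

text \<open>The \<open>INF\<close> lies below every value only if the objective is bounded below,
  which \<open>moreau_objective_ge\<close> supplies.\<close>

lemma moreau_env_le_objective:
  fixes g :: "'a::euclidean_space \<Rightarrow> real"
  assumes "L-lipschitz_on UNIV g" and "0 < \<mu>"
  shows "moreau_env \<mu> g z0 \<le> g z + 1 / (2 * \<mu>) * (norm (z - z0))\<^sup>2"
  unfolding moreau_env_def
  using moreau_objective_ge[OF assms] by (intro cINF_lower bdd_belowI2) auto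

text \<open>At a fixed z the two objectives differ by
  \<open>(\<mu> - \<nu>) / (2 * \<mu> * \<nu>)\<close> times the squared distance to
  \<open>z0\<close>, which is unbounded in z. Only the ball of radius \<open>2 * \<mu> * L\<close>
  matters: outside it the penalty for \<mu> offsets the Lipschitz loss, so the objective is at least
  \<open>g z0\<close>, hence at least the envelope for \<nu>.\<close>

lemma moreau_env_param_le:
  fixes g :: "'a::euclidean_space \<Rightarrow> real"
  assumes lip: "L-lipschitz_on UNIV g" and \<nu>: "0 < \<nu>" "\<nu> \<le> \<mu>"
  shows "moreau_env \<nu> g z0 \<le> moreau_env \<mu> g z0 + 2 * L\<^sup>2 * \<mu> * (\<mu> - \<nu>) / \<nu>"
proof -
  have \<mu>: "0 < \<mu>" using \<nu> by simp
  have L: "0 \<le> L" using lip by (rule lipschitz_on_nonneg)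
  let ?D = "2 * L\<^sup>2 * \<mu> * (\<mu> - \<nu>) / \<nu>"
  have D: "0 \<le> ?D" using \<nu> \<mu> by simp
  have "moreau_env \<nu> g z0 - ?D \<le> g z + 1 / (2 * \<mu>) * (norm (z - z0))\<^sup>2" for z
  proof (cases "norm (z - z0) \<le> 2 * \<mu> * L")
    case True
    let ?r = "norm (z - z0)"
    have "?r\<^sup>2 * ((\<mu> - \<nu>) / (2 * \<mu> * \<nu>)) \<le> (2 * \<mu> * L)\<^sup>2 * ((\<mu> - \<nu>) / (2 * \<mu> * \<nu>))"
      using True \<nu> \<mu> by (intro mult_right_mono power_mono) auto
    also have "\<dots> = ?D"
      using \<nu> \<mu> by (simp add: field_simps power2_eq_square)
    also have "?r\<^sup>2 * ((\<mu> - \<nu>) / (2 * \<mu> * \<nu>)) = 1 / (2 * \<nu>) * ?r\<^sup>2 - 1 / (2 * \<mu>) * ?r\<^sup>2"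
      using \<nu> \<mu> by (simp add: field_simps)
    finally show ?thesis
      using moreau_env_le_objective[OF lip \<nu>(1), of z0 z] by linarith
  next
    case False
    let ?r = "norm (z - z0)"
    have "g z0 - L * ?r \<le> g z"
      using lipschitz_onD[OF lip, of z z0] by (simp add: dist_norm)
    moreover have "2 * \<mu> * L * ?r \<le> ?r * ?r"
      using False by (intro mult_right_mono) auto
    hence "L * ?r \<le> 1 / (2 * \<mu>) * ?r\<^sup>2"
      using \<mu> by (simp add: field_simps power2_eq_square)
    moreover have "moreau_env \<nu> g z0 \<le> g z0"
      using moreau_env_le_objective[OF lip \<nu>(1), of z0 z0] by simp
    ultimately show ?thesis using D by linarith
  qed
  hence "moreau_env \<nu> g z0 - ?D \<le> moreau_env \<mu> g z0"
    unfolding moreau_env_def[of \<mu>] by (intro cINF_greatest) auto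
  thus ?thesis by linarith
qed

section \<open>Small terms under a bound on weighted sums of squares\<close>

lemma exists_small_of_weighted_square_sum:
  fixes \<delta> :: "nat \<Rightarrow> real"
  assumes sum_le: "\<And>N. (\<Sum>k = 1..N. real k powr (- 1 / 3) * (\<delta> k)\<^sup>2) \<le> K" and "0 < \<tau>"
  obtains B where "0 < B"
    and "\<And>\<epsilon>. 0 < \<epsilon> \<Longrightarrow>
      \<exists>n\<ge>1. real n \<le> B * (\<epsilon> powr (- 3) + 1) \<and> \<tau> * real n powr (- 1 / 3) \<le> \<epsilon> \<and> \<delta> n \<le> \<epsilon>"
proof -
  have K: "0 \<le> K" using sum_le[of 0] by simp
  \<comment> \<open>\<open>\<tau> \<le> R\<close> makes the smoothing parameter at most \<epsilon>
    from index \<open>m\<close> on; the other two summands yield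
    \<open>2 * K \<le> R\<^sup>2\<close>, which drives the contradiction.\<close>
  define R where "R = \<tau> + 2 * K + 1"
  have R: "1 \<le> R" "\<tau> \<le> R" "2 * K \<le> R" using K \<open>0 < \<tau>\<close> by (auto simp: R_def)
  have R2: "2 * K \<le> R\<^sup>2"
    using R K mult_mono[of 1 R "2 * K" R] by (simp add: power2_eq_square)
  show ?thesis
  proof (rule that[of "2 * R ^ 3 + 2"])
    show "0 < 2 * R ^ 3 + 2" using R by (simp add: add_pos_pos)
    fix \<epsilon> :: real
    assume \<epsilon>: "0 < \<epsilon>"
    define m where "m = nat \<lceil>(R / \<epsilon>) ^ 3\<rceil>"
    have pos: "0 < (R / \<epsilon>) ^ 3" using R \<epsilon> by simp
    have m_ge: "(R / \<epsilon>) ^ 3 \<le> real m" unfolding m_def by linarith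
    have m_le: "real m \<le> (R / \<epsilon>) ^ 3 + 1" unfolding m_def using pos by linarith
    have m1: "1 \<le> m" using m_ge pos by (cases m) auto
    define s where "s = real m powr (1 / 3)"
    have s_pos: "0 < s" using m1 by (simp add: s_def)
    have s3: "s ^ 3 = real m" using m1 by (simp add: s_def powr_power)
    have s_ge: "R / \<epsilon> \<le> s"
      using m_ge s_pos R \<epsilon> unfolding s3[symmetric] by (subst (asm) power_mono_iff) auto
    have "\<exists>n\<in>{m..2*m}. \<delta> n \<le> \<epsilon>"
    proof (rule ccontr)
      assume "\<not> ?thesis"
      hence big: "\<epsilon> < \<delta> k" if "k \<in> {m..2*m}" for k using that by (meson not_le)
      have w: "1 / (2 * s) \<le> real k powr (- 1 / 3)" if "k \<in> {m..2*m}" for k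
      proof -
        \<comment> \<open>The cruder bound \<open>8 * real m\<close> is chosen because 8 is a
          perfect cube.\<close>
        have "real k powr (1 / 3) \<le> (8 * real m) powr (1 / 3)"
          using that m1 by (intro powr_mono2) auto
        also have "\<dots> = (8::real) powr (1 / 3) * s" by (simp add: powr_mult s_def)
        also have "(8::real) powr (1 / 3) = (2 powr 3) powr (1 / 3)" by simp
        also have "\<dots> = 2" by (subst powr_powr) simp
        finally have "real k powr (1 / 3) \<le> 2 * s" .
        moreover have "0 < real k powr (1 / 3)" using that m1 by simp
        ultimately show ?thesis
          by (simp add: powr_minus_divide frac_le)
      qed
      have "real (m + 1) * (1 / (2 * s) * \<epsilon>\<^sup>2) = (\<Sum>k = m..2*m. 1 / (2 * s) * \<epsilon>\<^sup>2)"
        by simp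
      also have "\<dots> \<le> (\<Sum>k = m..2*m. real k powr (- 1 / 3) * (\<delta> k)\<^sup>2)"
        using w big \<epsilon> s_pos
        by (intro sum_mono mult_mono power_mono) (auto intro: less_imp_le)
      also have "\<dots> \<le> (\<Sum>k = 1..2*m. real k powr (- 1 / 3) * (\<delta> k)\<^sup>2)"
        using m1 by (intro sum_mono2) auto
      also have "\<dots> \<le> K" by (rule sum_le)
      finally have le: "real (m + 1) * (1 / (2 * s) * \<epsilon>\<^sup>2) \<le> K" .
      have "R \<le> s * \<epsilon>" using s_ge \<epsilon> by (simp add: field_simps)
      hence "R\<^sup>2 \<le> (s * \<epsilon>)\<^sup>2" using R by (intro power_mono) auto
      hence "K \<le> (s * \<epsilon>)\<^sup>2 / 2" using R2 by simp
      also have "\<dots> = real m * (1 / (2 * s) * \<epsilon>\<^sup>2)"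
        unfolding s3[symmetric] using s_pos
        by (simp add: field_simps power2_eq_square power3_eq_cube)
      \<comment> \<open>Already m terms of the block reach \<open>K\<close>; the remaining one of
        its m + 1 terms makes the inequality strict.\<close>
      also have "\<dots> < real (m + 1) * (1 / (2 * s) * \<epsilon>\<^sup>2)"
        using s_pos \<epsilon> by (intro mult_strict_right_mono) auto
      finally show False using le by simp
    qed
    then obtain n where n: "m \<le> n" "n \<le> 2 * m" "\<delta> n \<le> \<epsilon>" by auto
    have "\<tau> * real n powr (- 1 / 3) \<le> \<tau> * real m powr (- 1 / 3)"
      using n m1 \<open>0 < \<tau>\<close> by (intro mult_left_mono powr_mono2') auto
    also have "\<dots> = \<tau> / s" by (simp add: s_def powr_minus_divide)
    also have "\<dots> \<le> \<epsilon>"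
    proof -
      have "\<tau> \<le> s * \<epsilon>" using s_ge R \<epsilon> by (simp add: field_simps)
      thus ?thesis using s_pos by (simp add: field_simps)
    qed
    finally have small: "\<tau> * real n powr (- 1 / 3) \<le> \<epsilon>" .
    have "real n \<le> 2 * real m" using n(2) by linarith
    also have "\<dots> \<le> 2 * R ^ 3 * \<epsilon> powr (- 3) + 2"
      using m_le \<epsilon> by (simp add: powr_minus_divide power_divide)
    \<comment> \<open>The summand 2 stems from the ceiling in \<open>m\<close>; the
      \<open>+ 1\<close> in the bound absorbs it, so one constant serves every \<epsilon>, large
      ones included.\<close>
    also have "\<dots> \<le> (2 * R ^ 3 + 2) * (\<epsilon> powr (- 3) + 1)"
      using R \<epsilon> by (simp add: algebra_simps)
    finally show "\<exists>n\<ge>1. real n \<le> (2 * R ^ 3 + 2) * (\<epsilon> powr (- 3) + 1) \<and>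
        \<tau> * real n powr (- 1 / 3) \<le> \<epsilon> \<and> \<delta> n \<le> \<epsilon>"
      using small n m1 by (intro exI[of _ n]) auto
  qed
qed

section \<open>Counting oracle calls\<close>

lemma backtracking_SomeD:
  assumes "backtracking \<Omega> c \<rho> \<gamma>_init \<mu> y = Some (\<gamma>, k)"
  obtains m where "\<gamma> = \<rho> ^ m * \<gamma>_init" and "k = 5 * (m + 2)"
proof -
  obtain f d k0 where run: "run \<Omega> (eval_prog \<mu> y) = ((f, d), k0)"
    by (metis prod.collapse)
  have k0: "k0 = 5" using run_eval_prog_calls[of \<Omega> \<mu> y] run by simp
  \<comment> \<open>Every evaluation costs five calls wherever it is made, so the loop body no
    longer mentions the oracle. With the initial evaluation and the final successful test, m
    reductions cost m + 2 evaluations.\<close>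
  define step where "step = (\<lambda>(\<gamma> :: real, k :: nat). (\<rho> * \<gamma>, k + 5))"
  obtain P k' where "while_option P step (\<gamma>_init, 5) = Some (\<gamma>, k')" and k: "k = k' + 5"
    using assms unfolding backtracking_def run Let_def run_eval_prog_calls step_def k0
    by (auto split: prod.splits)
  then obtain m where m: "(\<gamma>, k') = (step ^^ m) (\<gamma>_init, 5)"
    using while_option_stop2 by metis
  have "(step ^^ j) (\<gamma>_init, 5) = (\<rho> ^ j * \<gamma>_init, 5 * (j + 1))" for j
    by (induction j) (auto simp: step_def)
  with m k show ?thesis by (intro that[of m]) auto
qed

lemma calls_until_le:
  assumes "1 \<le> n" and "P n" and "\<And>k. 1 \<le> k \<Longrightarrow> k \<le> n \<Longrightarrow> real (calls k) \<le> b" and "0 \<le> b"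
  shows "real (calls_until calls P) \<le> real n * b"
proof -
  let ?l = "LEAST n. 1 \<le> n \<and> P n"
  have l: "?l \<le> n" using assms(1,2) by (intro Least_le) auto
  have "real (calls_until calls P) = (\<Sum>k = 1..?l. real (calls k))"
    by (simp add: calls_until_def)
  also have "\<dots> \<le> (\<Sum>k = 1..?l. b)"
    using l assms(3) by (intro sum_mono) auto
  also have "\<dots> \<le> real n * b"
    using l assms(4) by (simp add: mult_right_mono)
  finally show ?thesis .
qed

section \<open>Complexity of the two stepsize rules\<close>

theorem corollary4p12:
  fixes C :: "'x::euclidean_space set"
    and h :: "'x \<Rightarrow> real"
    and S :: "'x \<Rightarrow> 'z::euclidean_space"
    and g :: "'z \<Rightarrow> real"
    and \<phi> :: "'y::euclidean_space \<Rightarrow> 'x"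
    and dimC :: nat
    and L_h L_g \<eta> c \<tau> \<omega>1 \<omega>2 \<beta> :: real
    and y1 :: 'y
    and y :: "nat \<Rightarrow> 'y"
    and \<gamma> \<mu> L :: "nat \<Rightarrow> real"
  assumes "C \<noteq> {}" and "connected C" and "closed C" and "embedded_submanifold dimC C"
    and "C1_on UNIV h" and "L_h > 0" and "L_h-lipschitz_on C (grad h)"
    and "C1_on UNIV S"
    and "L_g > 0" and "L_g-lipschitz_on UNIV g" and "\<eta> > 0" and "weakly_convex \<eta> g"
    and "bdd_below ((\<lambda>x. h x + g (S x)) ` C)"
    and "C1_on UNIV \<phi>" and "range \<phi> = C"
    and "0 < c" and "c < 1"
    and "0 < \<tau>" and "\<tau> \<le> 1 / (2 * \<eta>)"
    and mu: "\<forall>n\<ge>1. \<mu> n = \<tau> * real n powr (- 1 / 3)"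
    and iter: "y 1 = y1" "\<forall>n\<ge>1. \<gamma> n > 0"
      "\<forall>n\<ge>1. y (Suc n) = y n - \<gamma> n *\<^sub>R grad (smoothed h S g \<phi> (\<mu> n)) (y n)"
    and A: "\<omega>1 \<ge> 0" "\<omega>2 > 0" "\<forall>n\<ge>1. L n = \<omega>1 + \<omega>2 / \<mu> n"
      "\<forall>n\<ge>1. (L n)-lipschitz_on UNIV (grad (smoothed h S g \<phi> (\<mu> n)))"
    and B: "\<beta> > 0" "\<forall>n\<ge>1. \<gamma> n \<ge> \<beta> / L n"
      "\<forall>n\<ge>1. smoothed h S g \<phi> (\<mu> n) (y n - \<gamma> n *\<^sub>R grad (smoothed h S g \<phi> (\<mu> n)) (y n))
         \<le> smoothed h S g \<phi> (\<mu> n) (y n) - c * \<gamma> n * (norm (grad (smoothed h S g \<phi> (\<mu> n)) (y n)))\<^sup>2"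
  shows
    "((\<forall>n\<ge>1. \<gamma> n = 2 * (1 - c) / L n) \<longrightarrow>
        (\<forall>\<epsilon>>0. \<exists>n\<ge>1. approx_stationary h S g \<phi> \<eta> \<epsilon> (y n)) \<and>
        (\<lambda>\<epsilon>. real (calls_until
            (\<lambda>n. snd (run (fo_oracle h S g \<phi>) (eval_prog (\<mu> n) (y n))))
            (\<lambda>n. approx_stationary h S g \<phi> \<eta> \<epsilon> (y n))))
          \<in> O[at_right 0](\<lambda>\<epsilon>. \<epsilon> powr (- 3))) \<and>
     (\<forall>\<rho> \<gamma>_init calls. 0 < \<rho> \<longrightarrow> \<rho> < 1 \<longrightarrow> \<gamma>_init > 0 \<longrightarrow>
        (\<forall>n\<ge>1. backtracking (fo_oracle h S g \<phi>) c \<rho> \<gamma>_init (\<mu> n) (y n) = Some (\<gamma> n, calls n)) \<longrightarrow>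
        (\<forall>\<epsilon>>0. \<exists>n\<ge>1. approx_stationary h S g \<phi> \<eta> \<epsilon> (y n)) \<and>
        (\<lambda>\<epsilon>. real (calls_until calls (\<lambda>n. approx_stationary h S g \<phi> \<eta> \<epsilon> (y n))))
          \<in> O[at_right 0](\<lambda>\<epsilon>. \<epsilon> powr (- 3) * ln (1 / \<epsilon>)))"
proof -
  define F where "F = (\<lambda>n. smoothed h S g \<phi> (\<mu> n))"
  define d where "d = (\<lambda>n. norm (grad (F n) (y n)))"
  \<comment> \<open>Since \<open>\<omega>2 / \<mu> n\<close> is \<open>\<omega>2 / \<tau>\<close>
    times the cube root of n, and that root is at least 1, \<open>M\<close> times the root dominates
    \<open>L n\<close>.\<close>
  define M where "M = \<omega>1 + \<omega>2 / \<tau>"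
  have M: "0 < M" using A(1,2) \<open>0 < \<tau>\<close> by (simp add: M_def add_nonneg_pos)
  have \<mu>_pos: "0 < \<mu> n" if "1 \<le> n" for n using that mu \<open>0 < \<tau>\<close> by simp
  have \<mu>_le: "\<mu> n \<le> \<tau>" if "1 \<le> n" for n
    using that mu \<open>0 < \<tau>\<close> powr_mono2'[of "- 1 / 3" 1 "real n"] by simp
  have \<mu>_admissible: "\<mu> n < 1 / \<eta>" if "1 \<le> n" for n
  proof -
    have "1 / (2 * \<eta>) < 1 / \<eta>" using \<open>0 < \<eta>\<close> by (simp add: field_simps)
    thus ?thesis using \<mu>_le[OF that] \<open>\<tau> \<le> 1 / (2 * \<eta>)\<close> by linarith
  qed
  have \<mu>_decr: "\<mu> (Suc n) \<le> \<mu> n" if "1 \<le> n" for n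
    using that mu \<open>0 < \<tau>\<close> by (simp add: powr_mono2')
  have \<mu>_half: "\<mu> n \<le> 2 * \<mu> (Suc n)" if "1 \<le> n" for n
  proof -
    have "(8 * real n) powr (- 1 / 3) \<le> real (Suc n) powr (- 1 / 3)"
      using that by (intro powr_mono2') auto
    moreover have "(8 * real n) powr (- 1 / 3) = real n powr (- 1 / 3) / 2"
    proof -
      have "(8 * real n) powr (- 1 / 3) = (2 powr 3) powr (- 1 / 3) * real n powr (- 1 / 3)"
        by (simp add: powr_mult)
      also have "((2::real) powr 3) powr (- 1 / 3) = 1 / 2"
        by (subst powr_powr) (simp add: powr_minus_divide)
      finally show ?thesis by simp
    qed
    ultimately have "real n powr (- 1 / 3) \<le> 2 * real (Suc n) powr (- 1 / 3)" by linarith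
    thus ?thesis using that mu \<open>0 < \<tau>\<close> by simp
  qed

  have L_pos: "0 < L n" if "1 \<le> n" for n
    using that A(1-3) \<mu>_pos[OF that] by (simp add: add_nonneg_pos)
  have L_le: "L n \<le> M * real n powr (1 / 3)" if "1 \<le> n" for n
  proof -
    have "1 \<le> real n powr (1 / 3)" using that by (simp add: ge_one_powr_ge_zero)
    hence "\<omega>1 * 1 \<le> \<omega>1 * real n powr (1 / 3)" using A(1) by (intro mult_left_mono) auto
    moreover have "\<omega>2 / \<mu> n = \<omega>2 / \<tau> * real n powr (1 / 3)"
      using that mu by (simp add: powr_minus_divide)
    ultimately show ?thesis using that A(3) by (simp add: M_def algebra_simps)
  qed
  have \<gamma>_ge: "\<beta> / M * real n powr (- 1 / 3) \<le> \<gamma> n" if "1 \<le> n" for n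
  proof -
    have "\<beta> / (M * real n powr (1 / 3)) \<le> \<beta> / L n"
      using L_le[OF that] L_pos[OF that] B(1) by (intro divide_left_mono) auto
    thus ?thesis using that B(2) by (force simp: powr_minus_divide)
  qed

  have F_Suc: "F (Suc n) v \<le> F n v + 4 * L_g\<^sup>2 * (\<mu> n - \<mu> (Suc n))" if "1 \<le> n" for n v
  proof -
    \<comment> \<open>Bounding this ratio turns the drift from \<open>moreau_env_param_le\<close>
      into a constant multiple of \<open>\<mu> n - \<mu> (Suc n)\<close>, which telescopes.\<close>
    have "\<mu> n / \<mu> (Suc n) \<le> 2"
      using \<mu>_half[OF that] \<mu>_pos[of "Suc n"] by (simp add: field_simps)
    hence "2 * L_g\<^sup>2 * (\<mu> n - \<mu> (Suc n)) * (\<mu> n / \<mu> (Suc n))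
        \<le> 2 * L_g\<^sup>2 * (\<mu> n - \<mu> (Suc n)) * 2"
      using \<mu>_decr[OF that] by (intro mult_left_mono) auto
    hence "2 * L_g\<^sup>2 * \<mu> n * (\<mu> n - \<mu> (Suc n)) / \<mu> (Suc n)
        \<le> 4 * L_g\<^sup>2 * (\<mu> n - \<mu> (Suc n))"
      by (simp add: mult_ac)
    moreover have "moreau_env (\<mu> (Suc n)) g (S (\<phi> v)) \<le> moreau_env (\<mu> n) g (S (\<phi> v))
        + 2 * L_g\<^sup>2 * \<mu> n * (\<mu> n - \<mu> (Suc n)) / \<mu> (Suc n)"
      using \<mu>_pos[of "Suc n"] \<mu>_decr[OF that] by (intro moreau_env_param_le[OF assms(10)]) auto
    ultimately show ?thesis unfolding F_def smoothed_def by linarith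
  qed

  obtain b where b: "\<And>x. x \<in> C \<Longrightarrow> b \<le> h x + g (S x)"
    using assms(13) by (auto simp: bdd_below_def)
  \<comment> \<open>As \<open>\<phi>\<close> maps into \<open>C\<close>, the bound \<open>b\<close>
    applies; \<open>\<mu> n \<le> \<tau>\<close> makes the smoothing error uniform in n.\<close>
  have F_ge: "b - L_g\<^sup>2 * \<tau> / 2 \<le> F n v" if "1 \<le> n" for n v
  proof -
    have "g (S (\<phi> v)) - L_g\<^sup>2 * \<mu> n / 2 \<le> moreau_env (\<mu> n) g (S (\<phi> v))"
      by (rule moreau_env_ge[OF assms(10) \<mu>_pos[OF that]])
    moreover have "L_g\<^sup>2 * \<mu> n \<le> L_g\<^sup>2 * \<tau>" using \<mu>_le[OF that] by (intro mult_left_mono) auto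
    moreover have "b \<le> h (\<phi> v) + g (S (\<phi> v))" using b assms(15) by blast
    ultimately show ?thesis unfolding F_def smoothed_def by linarith
  qed

  text \<open>The correction term pays for the growth of the envelope as \<open>\<mu>\<close> decreases, so \<open>E\<close> still
    decreases along the iteration although the objective changes.\<close>
  define E where "E = (\<lambda>n. F n (y n) + 4 * L_g\<^sup>2 * \<mu> n)"
  have E_descent: "c * \<gamma> n * (d n)\<^sup>2 \<le> E n - E (Suc n)" if "1 \<le> n" for n
  proof -
    have "F n (y (Suc n)) \<le> F n (y n) - c * \<gamma> n * (d n)\<^sup>2"
      using that iter(3) B(3) by (simp add: F_def d_def)
    with F_Suc[OF that, of "y (Suc n)"] show ?thesis
      by (simp add: E_def algebra_simps)
  qed
  \<comment> \<open>The Armijo factor \<open>c\<close> times the coefficient in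
    \<open>\<gamma>_ge\<close>.\<close>
  define q where "q = c * \<beta> / M"
  have q: "0 < q" using \<open>0 < c\<close> B(1) M by (simp add: q_def)
  have step: "q * (real n powr (- 1 / 3) * (d n)\<^sup>2) \<le> E n - E (Suc n)" if "1 \<le> n" for n
  proof -
    have "q * (real n powr (- 1 / 3) * (d n)\<^sup>2) = c * (\<beta> / M * real n powr (- 1 / 3)) * (d n)\<^sup>2"
      by (simp add: q_def)
    also have "\<dots> \<le> c * \<gamma> n * (d n)\<^sup>2"
      using \<gamma>_ge[OF that] \<open>0 < c\<close> by (intro mult_right_mono mult_left_mono) auto
    finally show ?thesis using E_descent[OF that] by linarith
  qed
  have sum_bound: "(\<Sum>k = 1..N. real k powr (- 1 / 3) * (d k)\<^sup>2)
      \<le> (E 1 - (b - L_g\<^sup>2 * \<tau> / 2)) / q" for N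
  proof -
    have "q * (\<Sum>k = 1..N. real k powr (- 1 / 3) * (d k)\<^sup>2) \<le> (\<Sum>k = 1..N. E k - E (Suc k))"
      unfolding sum_distrib_left by (intro sum_mono step) simp
    also have "\<dots> = E 1 - E (Suc N)" by (induction N) auto
    also have "b - L_g\<^sup>2 * \<tau> / 2 \<le> E (Suc N)"
      using F_ge[of "Suc N" "y (Suc N)"] \<mu>_pos[of "Suc N"] by (simp add: E_def add_increasing2)
    hence "E 1 - E (Suc N) \<le> E 1 - (b - L_g\<^sup>2 * \<tau> / 2)" by simp
    finally show ?thesis using q by (simp add: field_simps)
  qed

  let ?P = "\<lambda>\<epsilon> n. approx_stationary h S g \<phi> \<eta> \<epsilon> (y n)"
  obtain K where K: "0 < K"
    and K': "\<And>\<epsilon>. 0 < \<epsilon> \<Longrightarrow> \<exists>n\<ge>1. real n \<le> K * (\<epsilon> powr (- 3) + 1) \<and>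
      \<tau> * real n powr (- 1 / 3) \<le> \<epsilon> \<and> d n \<le> \<epsilon>"
    using exists_small_of_weighted_square_sum[OF sum_bound \<open>0 < \<tau>\<close>] by metis
  have found: "\<exists>n\<ge>1. real n \<le> K * (\<epsilon> powr (- 3) + 1) \<and> ?P \<epsilon> n" if \<epsilon>: "0 < \<epsilon>" for \<epsilon>
  proof -
    obtain n where n: "1 \<le> n" "real n \<le> K * (\<epsilon> powr (- 3) + 1)"
      "\<tau> * real n powr (- 1 / 3) \<le> \<epsilon>" "d n \<le> \<epsilon>"
      using K'[OF \<epsilon>] by blast
    have "?P \<epsilon> n"
      unfolding approx_stationary_def using n mu \<mu>_pos \<mu>_admissible
      by (intro exI[of _ "\<mu> n"]) (auto simp: d_def F_def)
    with n(1,2) show ?thesis by blast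
  qed

  \<comment> \<open>One logarithmic cost model covers both rules: p = 5, r = 0 for the prescribed
    stepsize, and r > 0 for backtracking. The bound increases with the index, so its value at the
    bound on n covers all earlier iterations.\<close>
  have calls_bigo: "(\<lambda>\<epsilon>. real (calls_until calls (?P \<epsilon>)))
      \<in> O[at_right 0](\<lambda>\<epsilon>. K * (\<epsilon> powr (- 3) + 1) * (p + r * ln (K * (\<epsilon> powr (- 3) + 1))))"
    if calls: "\<And>n. 1 \<le> n \<Longrightarrow> real (calls n) \<le> p + r * ln (real n)" and "0 \<le> p" "0 \<le> r"
    for calls p r
  proof (rule bigoI[of _ 1], rule eventually_at_right_less[THEN eventually_mono])
    fix \<epsilon> :: real
    assume \<epsilon>: "0 < \<epsilon>"
    let ?B = "K * (\<epsilon> powr (- 3) + 1)"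
    obtain n where n: "1 \<le> n" "real n \<le> ?B" "?P \<epsilon> n" using found[OF \<epsilon>] by blast
    have B_ge: "1 \<le> ?B" using n by linarith
    have nonneg: "0 \<le> p + r * ln ?B"
      using B_ge \<open>0 \<le> p\<close> \<open>0 \<le> r\<close> by simp
    have "real (calls k) \<le> p + r * ln ?B" if "1 \<le> k" "k \<le> n" for k
    proof -
      have "ln (real k) \<le> ln ?B" using that n(2) by (subst ln_le_cancel_iff) auto
      thus ?thesis using calls[OF that(1)] mult_left_mono[OF _ \<open>0 \<le> r\<close>] by fastforce
    qed
    hence "real (calls_until calls (?P \<epsilon>)) \<le> real n * (p + r * ln ?B)"
      using n nonneg by (intro calls_until_le) auto
    also have "\<dots> \<le> ?B * (p + r * ln ?B)" using n nonneg by (intro mult_right_mono)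
    finally show "norm (real (calls_until calls (?P \<epsilon>))) \<le> 1 * norm (?B * (p + r * ln ?B))"
      by simp
  qed

  show ?thesis
  proof (intro conjI impI allI)
    show "\<exists>n\<ge>1. ?P \<epsilon> n" "\<exists>n\<ge>1. ?P \<epsilon> n" if "0 < \<epsilon>" for \<epsilon>
      using found[OF that] by blast+
  next
    have "(\<lambda>\<epsilon>. real (calls_until
            (\<lambda>n. snd (run (fo_oracle h S g \<phi>) (eval_prog (\<mu> n) (y n)))) (?P \<epsilon>)))
        \<in> O[at_right 0](\<lambda>\<epsilon>. K * (\<epsilon> powr (- 3) + 1) * (5 + 0 * ln (K * (\<epsilon> powr (- 3) + 1))))"
      by (rule calls_bigo) (simp_all add: run_eval_prog_calls)
    also have "(\<lambda>\<epsilon>. K * (\<epsilon> powr (- 3) + 1) * (5 + 0 * ln (K * (\<epsilon> powr (- 3) + 1))))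
        \<in> O[at_right 0](\<lambda>\<epsilon>. \<epsilon> powr (- 3))"
      using K by real_asymp
    finally show "(\<lambda>\<epsilon>. real (calls_until
            (\<lambda>n. snd (run (fo_oracle h S g \<phi>) (eval_prog (\<mu> n) (y n)))) (?P \<epsilon>)))
        \<in> O[at_right 0](\<lambda>\<epsilon>. \<epsilon> powr (- 3))" .
  next
    fix \<rho> \<gamma>_init :: real and calls :: "nat \<Rightarrow> nat"
    assume \<rho>: "0 < \<rho>" "\<rho> < 1" and \<gamma>_init: "\<gamma>_init > 0"
      and bt: "\<forall>n\<ge>1. backtracking (fo_oracle h S g \<phi>) c \<rho> \<gamma>_init (\<mu> n) (y n) = Some (\<gamma> n, calls n)"
    define \<theta> where "\<theta> = ln (1 / \<rho>)"
    have \<theta>: "0 < \<theta>" using \<rho> by (simp add: \<theta>_def ln_div)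
    \<comment> \<open>The absolute value keeps the constant part of the cost nonnegative, as
      \<open>calls_bigo\<close> requires.\<close>
    define \<kappa> where "\<kappa> = \<bar>ln (\<gamma>_init * M / \<beta>)\<bar>"
    have calls_le: "real (calls n) \<le> (10 + 5 * \<kappa> / \<theta>) + 5 / (3 * \<theta>) * ln (real n)" if n: "1 \<le> n" for n
    proof -
      obtain m where m: "\<gamma> n = \<rho> ^ m * \<gamma>_init" "calls n = 5 * (m + 2)"
        using bt n backtracking_SomeD by metis
      have "\<beta> / M * real n powr (- 1 / 3) \<le> \<rho> ^ m * \<gamma>_init" using \<gamma>_ge[OF n] m by simp
      hence "ln (\<beta> / M * real n powr (- 1 / 3)) \<le> ln (\<rho> ^ m * \<gamma>_init)"
        using \<rho> \<gamma>_init M B(1) n by (subst ln_le_cancel_iff) auto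
      \<comment> \<open>The logarithm turns the lower bound on the accepted stepsize into a bound on
        the number of reductions; the exponent -1/3 becomes \<open>ln (real n) / 3\<close>.\<close>
      hence "real m * \<theta> \<le> ln (\<gamma>_init * M / \<beta>) + ln (real n) / 3"
        using \<rho> \<gamma>_init M B(1) n by (simp add: ln_mult ln_div ln_realpow ln_powr \<theta>_def)
      also have "\<dots> \<le> \<kappa> + ln (real n) / 3" by (simp add: \<kappa>_def)
      finally have "real m \<le> (\<kappa> + ln (real n) / 3) / \<theta>"
        using \<theta> by (simp add: field_simps)
      thus ?thesis using m(2) by (simp add: add_divide_distrib)
    qed
    have "0 \<le> \<kappa>" by (simp add: \<kappa>_def)
    hence "(\<lambda>\<epsilon>. real (calls_until calls (?P \<epsilon>)))
        \<in> O[at_right 0](\<lambda>\<epsilon>. K * (\<epsilon> powr (- 3) + 1) *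
          ((10 + 5 * \<kappa> / \<theta>) + 5 / (3 * \<theta>) * ln (K * (\<epsilon> powr (- 3) + 1))))"
      using \<theta> by (intro calls_bigo calls_le) auto
    also have "(\<lambda>\<epsilon>. K * (\<epsilon> powr (- 3) + 1) *
          ((10 + 5 * \<kappa> / \<theta>) + 5 / (3 * \<theta>) * ln (K * (\<epsilon> powr (- 3) + 1))))
        \<in> O[at_right 0](\<lambda>\<epsilon>. \<epsilon> powr (- 3) * ln (1 / \<epsilon>))"
      \<comment> \<open>The inner logarithm is \<open>3 * ln (1 / \<epsilon>)\<close> up to a
        bounded term, and \<open>ln (1 / \<epsilon>)\<close> tends to infinity, so the constants are
        absorbed.\<close>
      using K \<theta> by real_asymp
    finally show "(\<lambda>\<epsilon>. real (calls_until calls (?P \<epsilon>)))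
        \<in> O[at_right 0](\<lambda>\<epsilon>. \<epsilon> powr (- 3) * ln (1 / \<epsilon>))" .
  qed
qed

end
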